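(* Let $(T_i)_{i\in K}$ be a family of continuous positive linear maps $l_\infty\to l_\infty$ with adjoints $T_i^*$, and let $F=\bigcap_{i\in K}\{p\in\Delta: p\text{ is an eigenvector of }T_i^*\}$. If $\succsim$ satisfies Weak order, Monotonicity, Continuity, ICRP, Convexity, ISU and I$T_i$IS for every $i\in K$, then there exists a nonempty weak$^\star$-closed set $D\subseteq F$ such that $I(x)=\min_{p\in D}\langle x,p\rangle$ is the unique constant equivalent representing $\succsim$. Conversely, if $I(x)=\min_{p\in D}\langle x,p\rangle$ for some nonempty weak$^\star$-closed $D\subseteq F$, and $\langle1,T_i^*(p)\rangle\le1$ for every $p\in F$ and $i\in K$, then the relation represented by $I$ satisfies Weak order, Monotonicity, Continuity, ICRP, Convexity, ISU and I$T_i$IS for every $i\in K$.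
   Context: $l_\infty$: real bounded sequences indexed by $\mathbb N$; $\theta\in\mathbb R$ also a constant sequence; $x\ge y$ coordinatewise. $ba(\mathbb N)$: norm dual of $l_\infty$, pairing $\langle x,\mu\rangle$, weak$^\star$ topology. Adjoint: $\langle x,T_i^*(\mu)\rangle=\langle T_i(x),\mu\rangle$. $\Delta$: finitely additive probability measures on $2^{\mathbb N}$. Eigenvector: nonzero $\mu$ with $T_i^*\mu=\lambda\mu$ for some real $\lambda$. Constant equivalent: $I$ with $x\sim I(x)$, $x\succsim y\iff I(x)\ge I(y)$. Weak order: complete, transitive. Monotonicity: $x\ge y\Rightarrow x\succsim y$, $1\succ0$. Continuity: for $x\succsim y\succsim z$ the sets $\{\alpha\in[0,1]:\alpha x+(1-\alpha)z\succsim y\}$, $\{\alpha:y\succsim\alpha x+(1-\alpha)z\}$ are closed. ICRP: $x\succsim y\Rightarrow x+\theta\succsim y+\theta$. Convexity: $x\succsim\theta,y\succsim\theta\Rightarrow\lambda x+(1-\lambda)y\succsim\theta$. ISU: $x\succsim y$, $\alpha\ge0\Rightarrow\alpha x\succsim\alpha y$. I$T_i$IS: $x+d\succsim x\Rightarrow x+T_i(d)\succsim x$. *)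

theory Defs
  imports "HOL-Analysis.Analysis"
begin

text \<open>l_infinity: bounded real sequences, as bounded (automatically continuous) functions on nat
  with the sup norm.  Its norm dual ba(N) is the type of bounded linear functionals.\<close>
type_synonym linf = "nat \<Rightarrow>\<^sub>C real"
type_synonym ba = "linf \<Rightarrow>\<^sub>L real"

definition cst :: "real \<Rightarrow> linf" where
  "cst \<theta> = const_bcontfun \<theta>"

definition vge :: "linf \<Rightarrow> linf \<Rightarrow> bool" where
  "vge x y \<longleftrightarrow> (\<forall>n. apply_bcontfun y n \<le> apply_bcontfun x n)"

definition ind :: "nat set \<Rightarrow> linf" where
  "ind A = Bcontfun (indicator A)"

text \<open>weak-star topology on ba: topology of pointwise convergence on l_infinity\<close>
definition weak_star :: "ba topology" where
  "weak_star = pullback_topology UNIV blinfun_apply euclidean"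

definition positive_op :: "(linf \<Rightarrow>\<^sub>L linf) \<Rightarrow> bool" where
  "positive_op T \<longleftrightarrow> (\<forall>x. vge x 0 \<longrightarrow> vge (blinfun_apply T x) 0)"

definition adjoint_op :: "(linf \<Rightarrow>\<^sub>L linf) \<Rightarrow> ba \<Rightarrow> ba" where
  "adjoint_op T \<mu> = \<mu> o\<^sub>L T"

definition eigenvector :: "(linf \<Rightarrow>\<^sub>L linf) \<Rightarrow> ba \<Rightarrow> bool" where
  "eigenvector T \<mu> \<longleftrightarrow> \<mu> \<noteq> 0 \<and> (\<exists>c::real. adjoint_op T \<mu> = c *\<^sub>R \<mu>)"

text \<open>Delta: elements of ba whose associated finitely additive set function
  A \<mapsto> <1_A, p> is a probability (nonnegative, total mass 1).\<close>
definition Delta :: "ba set" where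
  "Delta = {p. (\<forall>A. 0 \<le> blinfun_apply p (ind A)) \<and> blinfun_apply p (cst 1) = 1}"

definition weak_order :: "(linf \<Rightarrow> linf \<Rightarrow> bool) \<Rightarrow> bool" where
  "weak_order R \<longleftrightarrow> (\<forall>x y. R x y \<or> R y x) \<and> (\<forall>x y z. R x y \<longrightarrow> R y z \<longrightarrow> R x z)"

definition monotonicity :: "(linf \<Rightarrow> linf \<Rightarrow> bool) \<Rightarrow> bool" where
  "monotonicity R \<longleftrightarrow> (\<forall>x y. vge x y \<longrightarrow> R x y) \<and> (R (cst 1) (cst 0) \<and> \<not> R (cst 0) (cst 1))"

definition continuity :: "(linf \<Rightarrow> linf \<Rightarrow> bool) \<Rightarrow> bool" where
  "continuity R \<longleftrightarrow> (\<forall>x y z. R x y \<longrightarrow> R y z \<longrightarrow>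
      closed {\<alpha>::real \<in> {0..1}. R (\<alpha> *\<^sub>R x + (1 - \<alpha>) *\<^sub>R z) y} \<and>
      closed {\<alpha>::real \<in> {0..1}. R y (\<alpha> *\<^sub>R x + (1 - \<alpha>) *\<^sub>R z)})"

definition ICRP :: "(linf \<Rightarrow> linf \<Rightarrow> bool) \<Rightarrow> bool" where
  "ICRP R \<longleftrightarrow> (\<forall>x y \<theta>. R x y \<longrightarrow> R (x + cst \<theta>) (y + cst \<theta>))"

definition convexity :: "(linf \<Rightarrow> linf \<Rightarrow> bool) \<Rightarrow> bool" where
  "convexity R \<longleftrightarrow> (\<forall>x y \<theta> (t::real). R x (cst \<theta>) \<longrightarrow> R y (cst \<theta>) \<longrightarrow> 0 \<le> t \<longrightarrow> t \<le> 1 \<longrightarrow>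
      R (t *\<^sub>R x + (1 - t) *\<^sub>R y) (cst \<theta>))"

definition ISU :: "(linf \<Rightarrow> linf \<Rightarrow> bool) \<Rightarrow> bool" where
  "ISU R \<longleftrightarrow> (\<forall>x y \<alpha>::real. R x y \<longrightarrow> 0 \<le> \<alpha> \<longrightarrow> R (\<alpha> *\<^sub>R x) (\<alpha> *\<^sub>R y))"

definition ITIS :: "(linf \<Rightarrow>\<^sub>L linf) \<Rightarrow> (linf \<Rightarrow> linf \<Rightarrow> bool) \<Rightarrow> bool" where
  "ITIS T R \<longleftrightarrow> (\<forall>x d. R (x + d) x \<longrightarrow> R (x + blinfun_apply T d) x)"

definition constant_equivalent :: "(linf \<Rightarrow> linf \<Rightarrow> bool) \<Rightarrow> (linf \<Rightarrow> real) \<Rightarrow> bool" where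
  "constant_equivalent R I \<longleftrightarrow> (\<forall>x. R x (cst (I x)) \<and> R (cst (I x)) x) \<and> (\<forall>x y. R x y \<longleftrightarrow> I y \<le> I x)"

definition min_rep :: "ba set \<Rightarrow> (linf \<Rightarrow> real) \<Rightarrow> bool" where
  "min_rep D I \<longleftrightarrow> (\<forall>x. (\<exists>p\<in>D. blinfun_apply p x = I x) \<and> (\<forall>p\<in>D. I x \<le> blinfun_apply p x))"

end

theory Submission
  imports Defs
begin

text \<open>The axioms yield a superlinear, monotone, translation invariant \<open>I\<close> that is invariant under the
  \<open>T\<^sub>i\<close>. Invariance survives directed suprema, hence also passes to the directional derivatives of \<open>I\<close>.
  By Zorn's lemma some functional of this kind is maximal above the directional derivative of \<open>I\<close> at
  \<open>x\<close>; being equal to all its own directional derivatives it is linear, say \<open>p\<close>. For linear \<open>p\<close>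
  invariance reads \<open>p d \<ge> 0 \<Longrightarrow> p (T\<^sub>i d) \<ge> 0\<close>, so \<open>p\<close> and \<open>p \<circ> T\<^sub>i\<close> are proportional, and
  \<open>p x = I x\<close>. Conversely, the eigenvalues \<open>c\<close> lie in \<open>[0,1]\<close>, and \<open>p (x + T\<^sub>i d)\<close> is the convex
  combination of \<open>p x\<close> and \<open>p (x + d)\<close> with weight \<open>c\<close>.\<close>

section \<open>Constant sequences and the coordinatewise order\<close>

lemma apply_cst [simp]: "apply_bcontfun (cst \<theta>) n = \<theta>"
  by (simp add: cst_def)

lemma cst_0 [simp]: "cst 0 = 0"
  by (simp add: cst_def)

lemma cst_add: "cst (a + b) = cst a + cst b"
  by (rule bcontfun_eqI) simp

lemma scaleR_cst [simp]: "a *\<^sub>R cst b = cst (a * b)"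
  by (rule bcontfun_eqI) simp

lemma vge_norm: "vge (cst (norm x)) x" "vge x (cst (- norm x))"
proof -
  have "\<bar>apply_bcontfun x n\<bar> \<le> norm x" for n
    using norm_bounded[of x n] by simp
  then show "vge (cst (norm x)) x" "vge x (cst (- norm x))"
    by (auto simp: vge_def abs_le_iff minus_le_iff)
qed

section \<open>Normalized niveloids and superlinear functionals\<close>

text \<open>Invariance is phrased as \<open>ITIS\<close> of the preference induced by
  \<open>g\<close>, so the axiom carries over verbatim. For \<open>\<S> = {}\<close> what remains is
  a normalized niveloid.\<close>

definition niveloid :: "(linf \<Rightarrow>\<^sub>L linf) set \<Rightarrow> (linf \<Rightarrow> real) \<Rightarrow> bool" where
  "niveloid \<S> g \<longleftrightarrow> g 0 = 0 \<and> (\<forall>x y. vge x y \<longrightarrow> g y \<le> g x) \<and> (\<forall>x \<theta>. g (x + cst \<theta>) = g x + \<theta>) \<and>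
     (\<forall>S\<in>\<S>. ITIS S (\<lambda>x y. g y \<le> g x))"

definition superlinear :: "('a::real_vector \<Rightarrow> real) \<Rightarrow> bool" where
  "superlinear g \<longleftrightarrow> (\<forall>x y. g x + g y \<le> g (x + y)) \<and> (\<forall>c x. 0 < c \<longrightarrow> g (c *\<^sub>R x) = c * g x)"

lemma niveloid_mono: "niveloid \<S> g \<Longrightarrow> vge x y \<Longrightarrow> g y \<le> g x"
  and niveloid_add_cst: "niveloid \<S> g \<Longrightarrow> g (x + cst \<theta>) = g x + \<theta>"
  and niveloid_0: "niveloid \<S> g \<Longrightarrow> g 0 = 0"
  and niveloid_ITIS: "niveloid \<S> g \<Longrightarrow> S \<in> \<S> \<Longrightarrow> g x \<le> g (x + d) \<Longrightarrow> g x \<le> g (x + blinfun_apply S d)"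
  unfolding niveloid_def ITIS_def by blast+

lemma niveloid_cst: "niveloid \<S> g \<Longrightarrow> g (cst \<theta>) = \<theta>"
  using niveloid_add_cst[of \<S> g 0 \<theta>] niveloid_0[of \<S> g] by simp

lemma niveloid_le_norm:
  assumes "niveloid \<S> g"
  shows "g x \<le> norm x" "- norm x \<le> g x"
  using niveloid_mono[OF assms vge_norm(1)] niveloid_mono[OF assms vge_norm(2)]
  by (simp_all add: niveloid_cst[OF assms])

lemma superlinear_add: "superlinear g \<Longrightarrow> g x + g y \<le> g (x + y)"
  and superlinear_scaleR: "superlinear g \<Longrightarrow> 0 < c \<Longrightarrow> g (c *\<^sub>R x) = c * g x"
  unfolding superlinear_def by blast+

lemma superlinear_0: "superlinear g \<Longrightarrow> g 0 = 0"
  using superlinear_scaleR[of g 2 0] by simp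

lemma superlinear_scaleR_nonneg: "superlinear g \<Longrightarrow> 0 \<le> c \<Longrightarrow> g (c *\<^sub>R x) = c * g x"
  by (cases "c = 0") (simp_all add: superlinear_0 superlinear_scaleR)

section \<open>Suprema, directional derivatives and maximal elements\<close>

text \<open>Serves both directional derivatives and chains in Zorn's lemma. \<open>add\<close> makes
  \<open>G\<close> directed and the supremum superadditive; \<open>scale\<close> gives homogeneity.
  Invariance is the delicate part: a weak inequality for the supremum need not hold for any member,
  so a small constant first makes it strict.\<close>

lemma niveloid_SUP:
  assumes ne: "G \<noteq> {}" and nivG: "\<forall>g\<in>G. niveloid \<S> g"
    and add: "\<forall>g\<in>G. \<forall>h\<in>G. \<exists>k\<in>G. \<forall>x y. g x + h y \<le> k (x + y)"
    and scale: "\<forall>g\<in>G. \<forall>c>0. \<exists>k\<in>G. \<forall>x. c * g x \<le> k (c *\<^sub>R x)"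
  defines "J \<equiv> \<lambda>x. SUP g\<in>G. g x"
  shows "niveloid \<S> J" "superlinear J" "g \<in> G \<Longrightarrow> g x \<le> J x"
proof -
  note niv = bspec[OF nivG]
  have bdd: "bdd_above ((\<lambda>g. g x) ` G)" for x
    using niveloid_le_norm(1)[OF niv] by (intro bdd_aboveI[of _ "norm x"]) auto
  have up: "g x \<le> J x" if "g \<in> G" for g x
    unfolding J_def by (rule cSUP_upper[OF that bdd])
  have least: "J x \<le> b" if "\<And>g. g \<in> G \<Longrightarrow> g x \<le> b" for x b
    unfolding J_def by (rule cSUP_least[OF ne that])
  \<comment> \<open>Putting 0 in one argument of \<open>add\<close> yields a common upper bound, as
    members vanish at 0.\<close>
  have dir: "\<exists>k\<in>G. (\<forall>x. g x \<le> k x) \<and> (\<forall>x. h x \<le> k x)" if gh: "g \<in> G" "h \<in> G" for g h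
  proof -
    obtain k where k: "k \<in> G" "\<And>x y. g x + h y \<le> k (x + y)"
      using add gh by blast
    have "g x \<le> k x" "h x \<le> k x" for x
      using k(2)[of x 0] k(2)[of 0 x] niveloid_0[OF niv[OF gh(1)]] niveloid_0[OF niv[OF gh(2)]]
      by simp_all
    then show ?thesis using k(1) by blast
  qed
  have J0: "J 0 = 0"
    unfolding J_def using ne by (simp add: niveloid_0[OF niv])
  have mono: "J y \<le> J x" if "vge x y" for x y
    by (rule least) (rule order_trans[OF niveloid_mono[OF niv that] up])
  have trans_le: "J (x + cst \<theta>) \<le> J x + \<theta>" for x \<theta>
    by (rule least) (simp add: niveloid_add_cst[OF niv] up)
  have trans: "J (x + cst \<theta>) = J x + \<theta>" for x \<theta>
    using trans_le[of x \<theta>] trans_le[of "x + cst \<theta>" "- \<theta>"] by (simp add: add.assoc flip: cst_add)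
  have "ITIS S (\<lambda>x y. J y \<le> J x)" if S: "S \<in> \<S>" for S
    unfolding ITIS_def
  proof (intro allI impI)
    fix x d
    assume le: "J x \<le> J (x + d)"
    show "J x \<le> J (x + blinfun_apply S d)"
    proof (rule field_le_epsilon)
      fix e :: real
      assume e: "0 < e"
      define M where "M = norm (blinfun_apply S (cst 1))"
      define \<delta> where "\<delta> = e / (M + 1)"
      have M: "0 \<le> M" by (simp add: M_def)
      have \<delta>: "0 < \<delta>" "\<delta> * M \<le> e"
        using e M by (simp_all add: \<delta>_def field_simps)
      \<comment> \<open>Adding \<open>\<delta>\<close> makes the inequality strict, so a single
        member \<open>g\<close> already exceeds \<open>J x\<close>.\<close>
      have "J x < J (x + (d + cst \<delta>))"
        using le \<delta>(1) trans[of "x + d" \<delta>] by (simp add: add.assoc)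
      then obtain g where g: "g \<in> G" "J x < g (x + (d + cst \<delta>))"
        unfolding J_def using less_cSUP_iff[OF ne bdd] by blast
      have S1: "blinfun_apply S (cst \<delta>) = \<delta> *\<^sub>R blinfun_apply S (cst 1)"
        by (simp flip: blinfun.scaleR_right)
      have "vge (cst (\<delta> * M)) (blinfun_apply S (cst \<delta>))"
        using vge_norm(1)[of "blinfun_apply S (cst 1)"] \<delta>(1)
        unfolding S1 vge_def M_def by simp
      then have vge: "vge (x + blinfun_apply S d + cst (\<delta> * M)) (x + blinfun_apply S (d + cst \<delta>))"
        by (simp add: vge_def blinfun.add_right)
      show "J x \<le> J (x + blinfun_apply S d) + e"
      proof (rule least)
        \<comment> \<open>An arbitrary \<open>h\<close> is bounded through a \<open>k\<close> above
          both \<open>g\<close> and \<open>h\<close>: \<open>k x\<close> is at most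
          \<open>J x\<close>, hence below \<open>g\<close> and so below \<open>k\<close> at the
          shifted point, and the invariance of \<open>k\<close> applies.\<close>
        fix h assume h: "h \<in> G"
        obtain k where k: "k \<in> G" "\<And>x. g x \<le> k x" "\<And>x. h x \<le> k x"
          using dir[OF g(1) h] by blast
        have "k x \<le> k (x + (d + cst \<delta>))"
          using up[OF k(1), of x] g(2) k(2)[of "x + (d + cst \<delta>)"] by linarith
        then have "k x \<le> k (x + blinfun_apply S (d + cst \<delta>))"
          by (rule niveloid_ITIS[OF niv[OF k(1)] S])
        also have "\<dots> \<le> J (x + blinfun_apply S (d + cst \<delta>))"
          by (rule up[OF k(1)])
        also have "\<dots> \<le> J (x + blinfun_apply S d) + \<delta> * M"
          using mono[OF vge] trans by simp
        finally show "h x \<le> J (x + blinfun_apply S d) + e"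
          using k(3)[of x] \<delta>(2) by linarith
      qed
    qed
  qed
  with J0 mono trans show "niveloid \<S> J"
    unfolding niveloid_def by blast
  have "J x + J y \<le> J (x + y)" for x y
  proof -
    have "J x \<le> J (x + y) - J y"
    proof (rule least)
      fix g assume g: "g \<in> G"
      have "J y \<le> J (x + y) - g x"
      proof (rule least)
        fix h assume h: "h \<in> G"
        obtain k where k: "k \<in> G" "g x + h y \<le> k (x + y)"
          using add g h by blast
        then show "h y \<le> J (x + y) - g x"
          using up[OF k(1), of "x + y"] by linarith
      qed
      then show "g x \<le> J (x + y) - J y" by linarith
    qed
    then show ?thesis by linarith
  qed
  moreover have le: "c * J x \<le> J (c *\<^sub>R x)" if c: "0 < c" for c x
  proof -
    have "J x \<le> J (c *\<^sub>R x) / c"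
    proof (rule least)
      fix g assume g: "g \<in> G"
      obtain k where k: "k \<in> G" "c * g x \<le> k (c *\<^sub>R x)"
        using scale g c by blast
      then show "g x \<le> J (c *\<^sub>R x) / c"
        using up[OF k(1), of "c *\<^sub>R x"] c by (simp add: field_simps)
    qed
    then show ?thesis using c by (simp add: field_simps)
  qed
  moreover have "J (c *\<^sub>R x) = c * J x" if c: "0 < c" for c x
    using le[OF c, of x] le[of "inverse c" "c *\<^sub>R x"] c by (simp add: field_simps)
  ultimately show "superlinear J"
    unfolding superlinear_def by blast
  show "g x \<le> J x" if "g \<in> G" for g x
    by (rule up[OF that])
qed

text \<open>For superlinear \<open>I\<close> the quotients \<open>(I (x + t y) - I x) / t\<close> increase as \<open>t = 1 / s\<close> decreases, so the
  supremum below is the directional derivative of \<open>I\<close> at \<open>x\<close>. By homogeneity each term, as a function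
  of \<open>y\<close>, is a translate of \<open>I\<close> and so inherits its invariances.\<close>
lemma directional_derivative:
  assumes niv: "niveloid \<S> I" and sup: "superlinear I"
  obtains J where "niveloid \<S> J" "superlinear J" "I \<le> J" "J (- x) \<le> - I x" "- I x \<le> J (- x)"
proof -
  define g where "g = (\<lambda>s y. I (s *\<^sub>R x + y) - s * I x)"
  define G where "G = g ` {0::real..}"
  define J where "J = (\<lambda>y. SUP h\<in>G. h y)"
  note hom = superlinear_scaleR_nonneg[OF sup]
  have ne: "G \<noteq> {}" by (auto simp: G_def)
  have gniv: "niveloid \<S> h" if h: "h \<in> G" for h
  proof -
    obtain s where s: "0 \<le> s" "h = g s" using h by (auto simp: G_def)
    have "vge (s *\<^sub>R x + y) (s *\<^sub>R x + z)" if "vge y z" for y z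
      using that by (simp add: vge_def)
    then have "g s z \<le> g s y" if "vge y z" for y z
      using that niveloid_mono[OF niv] by (simp add: g_def)
    moreover have "g s (y + cst \<theta>) = g s y + \<theta>" for y \<theta>
      using niveloid_add_cst[OF niv, of "s *\<^sub>R x + y" \<theta>] by (simp add: g_def add.assoc)
    moreover have "ITIS S (\<lambda>y z. g s z \<le> g s y)" if "S \<in> \<S>" for S
      using niveloid_ITIS[OF niv that] by (simp add: ITIS_def g_def flip: add.assoc)
    moreover have "g s 0 = 0" using hom[OF s(1)] by (simp add: g_def)
    ultimately show ?thesis unfolding niveloid_def s by blast
  qed
  have gadd: "\<exists>k\<in>G. \<forall>y z. h y + h' z \<le> k (y + z)" if hh: "h \<in> G" "h' \<in> G" for h h'
  proof -
    obtain s s' where s: "0 \<le> s" "h = g s" "0 \<le> s'" "h' = g s'"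
      using hh by (auto simp: G_def)
    have "g s y + g s' z \<le> g (s + s') (y + z)" for y z
      using superlinear_add[OF sup, of "s *\<^sub>R x + y" "s' *\<^sub>R x + z"]
      by (simp add: g_def algebra_simps)
    then show ?thesis using s by (intro bexI[of _ "g (s + s')"]) (auto simp: G_def)
  qed
  have gscale: "\<exists>k\<in>G. \<forall>y. c * h y \<le> k (c *\<^sub>R y)" if h: "h \<in> G" and c: "0 < c" for h c
  proof -
    obtain s where s: "0 \<le> s" "h = g s" using h by (auto simp: G_def)
    have "c * g s y \<le> g (c * s) (c *\<^sub>R y)" for y
      using superlinear_scaleR[OF sup c, of "s *\<^sub>R x + y"] by (simp add: g_def algebra_simps)
    then show ?thesis using s c by (intro bexI[of _ "g (c * s)"]) (auto simp: G_def)
  qed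
  have "\<forall>h\<in>G. niveloid \<S> h" "\<forall>h\<in>G. \<forall>h'\<in>G. \<exists>k\<in>G. \<forall>y z. h y + h' z \<le> k (y + z)"
    "\<forall>h\<in>G. \<forall>c>0. \<exists>k\<in>G. \<forall>y. c * h y \<le> k (c *\<^sub>R y)"
    using gniv gadd gscale by blast+
  note J = niveloid_SUP[OF ne this, folded J_def]
  \<comment> \<open>\<open>g 0\<close> is \<open>I\<close> itself, and \<open>g 1\<close> takes the
    value \<open>- I x\<close> at \<open>- x\<close>.\<close>
  have g0: "g 0 \<in> G" and g1: "g 1 \<in> G" by (auto simp: G_def)
  have IJ: "I \<le> J"
    using J(3)[OF g0] by (simp add: le_fun_def g_def J_def)
  have "- I x \<le> J (- x)"
    using J(3)[OF g1, of "- x"] superlinear_0[OF sup] by (simp add: g_def J_def)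
  moreover have "J (- x) \<le> - I x"
    using superlinear_add[OF J(2), of x "- x"] superlinear_0[OF J(2)] le_funD[OF IJ, of x] by simp
  ultimately show ?thesis using that J(1,2) IJ by blast
qed

text \<open>Zorn's lemma in the pointwise order. A maximal \<open>J\<close> equals its directional
  derivative at every \<open>x\<close>, whose value at \<open>- x\<close> is \<open>- J x\<close>;
  oddness turns superlinearity into linearity.\<close>

lemma maximal_superlinear_niveloid:
  assumes I: "niveloid \<S> I" "superlinear I"
  obtains J where "niveloid \<S> J" "superlinear J" "I \<le> J" "\<And>x. J (- x) = - J x"
proof -
  define A where "A = {J. niveloid \<S> J \<and> superlinear J \<and> I \<le> J}"
  have "\<exists>m\<in>A. \<forall>a\<in>A. m \<le> a \<longrightarrow> a = m"
  proof (rule predicate_Zorn)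
    show "partial_order_on A (relation_of (\<le>) A)"
      by (rule partial_order_on_relation_ofI) auto
    fix C assume C: "C \<in> Chains (relation_of (\<le>) A)"
    have CA: "C \<subseteq> A" by (rule Chains_relation_of[OF C])
    have chain: "g \<le> h \<or> h \<le> g" if "g \<in> C" "h \<in> C" for g h
      using C that by (auto simp: Chains_def relation_of_def)
    show "\<exists>u\<in>A. \<forall>a\<in>C. a \<le> u"
    proof (cases "C = {}")
      \<comment> \<open>The empty chain has no usable supremum; \<open>I\<close> lies in
        \<open>A\<close> and serves as its bound.\<close>
      case True
      then show ?thesis using I by (auto simp: A_def)
    next
      case ne: False
      have add: "\<exists>k\<in>C. \<forall>x y. g x + h y \<le> k (x + y)" if gh: "g \<in> C" "h \<in> C" for g h
      proof -
        define k where "k = (if g \<le> h then h else g)"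
        have k: "k \<in> C" "g \<le> k" "h \<le> k"
          using chain[OF gh] gh by (auto simp: k_def)
        have "superlinear k" using k(1) CA by (auto simp: A_def)
        then have "g x + h y \<le> k (x + y)" for x y
          using superlinear_add[of k x y] le_funD[OF k(2), of x] le_funD[OF k(3), of y] by linarith
        with k(1) show ?thesis by blast
      qed
      have scale: "\<exists>k\<in>C. \<forall>x. c * g x \<le> k (c *\<^sub>R x)" if "g \<in> C" "0 < c" for g c
        using that CA superlinear_scaleR[of g c] by (intro bexI[of _ g]) (auto simp: A_def)
      define J where "J = (\<lambda>x. SUP g\<in>C. g x)"
      have "\<forall>g\<in>C. niveloid \<S> g" "\<forall>g\<in>C. \<forall>h\<in>C. \<exists>k\<in>C. \<forall>x y. g x + h y \<le> k (x + y)"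
        "\<forall>g\<in>C. \<forall>c>0. \<exists>k\<in>C. \<forall>x. c * g x \<le> k (c *\<^sub>R x)"
        using CA add scale by (auto simp: A_def)
      note J = niveloid_SUP[OF ne this, folded J_def]
      have up: "\<forall>g\<in>C. g \<le> J" using J(3) by (simp add: le_fun_def J_def)
      moreover obtain g where "g \<in> C" using ne by blast
      ultimately have "I \<le> J" using CA by (force simp: A_def)
      with J(1,2) up show ?thesis by (auto simp: A_def)
    qed
  qed
  then obtain J where J: "J \<in> A" and max: "\<And>J'. J' \<in> A \<Longrightarrow> J \<le> J' \<Longrightarrow> J' = J" by blast
  have Jp: "niveloid \<S> J" "superlinear J" "I \<le> J" using J by (auto simp: A_def)
  have "J (- x) = - J x" for x
  proof -
    \<comment> \<open>The derivative \<open>J'\<close> of \<open>J\<close> at \<open>x\<close> lies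
      in \<open>A\<close> above \<open>J\<close>, so maximality forces
      \<open>J' = J\<close>.\<close>
    obtain J' where J': "niveloid \<S> J'" "superlinear J'" "J \<le> J'" "J' (- x) \<le> - J x" "- J x \<le> J' (- x)"
      using directional_derivative[OF Jp(1,2)] by metis
    then have "J' \<in> A" using Jp(3) order_trans by (auto simp: A_def)
    with max J' show ?thesis by force
  qed
  with Jp that show ?thesis by blast
qed

text \<open>Maximizing above the derivative of \<open>I\<close> at \<open>x\<close>, rather than
  above \<open>I\<close> itself, makes \<open>p\<close> touch \<open>I\<close> at \<open>x\<close>:
  its value at \<open>- x\<close> is at least \<open>- I x\<close>. The eigenvalue is explicitly
  \<open>p (S 1)\<close>, because \<open>p\<close> has mass 1.\<close>

lemma supporting_eigenvector:
  assumes I: "niveloid \<S> I" "superlinear I"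
  obtains p :: ba where "blinfun_apply p x = I x" "\<And>y. I y \<le> blinfun_apply p y"
    "\<And>S y. S \<in> \<S> \<Longrightarrow>
      blinfun_apply p (blinfun_apply S y) = blinfun_apply p (blinfun_apply S (cst 1)) * blinfun_apply p y"
proof -
  obtain I' where I': "niveloid \<S> I'" "superlinear I'" "I \<le> I'" "- I x \<le> I' (- x)"
    using directional_derivative[OF I] by metis
  obtain J where J: "niveloid \<S> J" "superlinear J" "I' \<le> J" and neg: "\<And>y. J (- y) = - J y"
    using maximal_superlinear_niveloid[OF I'(1,2)] by blast
  have IJ: "I y \<le> J y" for y
    using le_funD[OF I'(3), of y] le_funD[OF J(3), of y] by linarith
  \<comment> \<open>Superadditivity at \<open>- y\<close> and \<open>- z\<close>, combined with
    oddness, gives the reverse inequality.\<close>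
  have add: "J (y + z) = J y + J z" for y z
    using superlinear_add[OF J(2), of y z] superlinear_add[OF J(2), of "- y" "- z"] neg[of "y + z"]
    by (simp add: neg)
  have scale: "J (c *\<^sub>R y) = c * J y" for c y
  proof (cases "0 \<le> c")
    case True
    then show ?thesis by (rule superlinear_scaleR_nonneg[OF J(2)])
  next
    case False
    then show ?thesis
      using superlinear_scaleR[OF J(2), of "- c" y] neg[of "c *\<^sub>R y"] by simp
  qed
  have "bounded_linear J"
    using niveloid_le_norm[OF J(1)]
    by (intro bounded_linear_intro[of _ 1]) (auto simp: add scale abs_le_iff minus_le_iff)
  then have app: "blinfun_apply (Blinfun J) = J" by (rule bounded_linear_Blinfun_apply)
  have diff: "J (y - z) = J y - J z" for y z
    using add[of y "- z"] by (simp add: neg)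
  have "J (blinfun_apply S y) = J (blinfun_apply S (cst 1)) * J y" if S: "S \<in> \<S>" for S y
  proof -
    have pos: "0 \<le> J (blinfun_apply S d)" if "0 \<le> J d" for d
      using niveloid_ITIS[OF J(1) S, of 0 d] that by (simp add: niveloid_0[OF J(1)])
    \<comment> \<open>\<open>d\<close> is \<open>y\<close> projected to the kernel of
      \<open>J\<close> along the constants. By \<open>pos\<close> at \<open>d\<close> and
      \<open>- d\<close>, \<open>S\<close> maps it into the kernel again.\<close>
    define d where "d = y - J y *\<^sub>R cst 1"
    have "J d = 0"
      by (simp add: d_def diff niveloid_cst[OF J(1)])
    then have "J (blinfun_apply S d) = 0"
      using pos[of d] pos[of "- d"] by (simp add: neg blinfun.minus_right)
    then show ?thesis
      unfolding d_def by (simp only: diff scale blinfun.diff_right blinfun.scaleR_right) simp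
  qed
  moreover have "J x = I x"
    using IJ[of x] neg[of x] I'(4) le_funD[OF J(3), of "- x"] by linarith
  ultimately show ?thesis
    using that[of "Blinfun J"] IJ unfolding app by blast
qed

section \<open>From the axioms to a superlinear constant equivalent\<close>

lemma constant_equivalent_unique:
  assumes "constant_equivalent R I" "constant_equivalent R J" and wo: "weak_order R"
    and strict: "\<And>a b. R (cst a) (cst b) \<Longrightarrow> b \<le> a"
  shows "J = I"
proof
  fix x
  have "R (cst (J x)) (cst (I x))" "R (cst (I x)) (cst (J x))"
    using assms(1,2) wo unfolding constant_equivalent_def weak_order_def by blast+
  then show "J x = I x" using strict by (meson order_antisym)
qed

text \<open>The only strict preference in the axioms is 1 over 0; ICRP and ISU carry a hypothetical
  violation \<open>a < b\<close> over to this pair.\<close>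

lemma constant_preference_iff:
  assumes "monotonicity R" "ICRP R" "ISU R"
  shows "R (cst a) (cst b) \<longleftrightarrow> b \<le> a"
proof
  show "R (cst a) (cst b)" if "b \<le> a"
    using that assms(1) by (simp add: monotonicity_def vge_def)
  show "b \<le> a" if "R (cst a) (cst b)"
  proof (rule ccontr)
    assume "\<not> b \<le> a"
    then have pos: "0 \<le> inverse (b - a)" by simp
    have "R (cst a + cst (- a)) (cst b + cst (- a))"
      using that assms(2) unfolding ICRP_def by blast
    then have "R (cst 0) (cst (b - a))" by (simp flip: cst_add)
    then have "R (inverse (b - a) *\<^sub>R cst 0) (inverse (b - a) *\<^sub>R cst (b - a))"
      using assms(3) pos unfolding ISU_def by blast
    then show False
      using assms(1) \<open>\<not> b \<le> a\<close> by (simp add: monotonicity_def del: cst_0)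
  qed
qed

text \<open>Continuity yields the constant equivalent, ICRP its translation invariance and ISU its
  homogeneity. Convexity gives superadditivity once both arguments are shifted to level 0.\<close>

lemma superlinear_niveloid_representation:
  assumes wo: "weak_order R" and mono: "monotonicity R" and cont: "continuity R" and icrp: "ICRP R"
    and conv: "convexity R" and isu: "ISU R" and itis: "\<forall>S\<in>\<S>. ITIS S R"
  obtains I where "constant_equivalent R I" "niveloid \<S> I" "superlinear I"
proof -
  have trans: "R x z" if "R x y" "R y z" for x y z
    using wo that unfolding weak_order_def by blast
  have shift: "R (x + cst \<theta>) (y + cst \<theta>)" if "R x y" for x y \<theta>
    using icrp that unfolding ICRP_def by blast
  have scale: "R (c *\<^sub>R x) (c *\<^sub>R y)" if "R x y" "0 \<le> c" for c x y
    using isu that unfolding ISU_def by blast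
  have vgeR: "R x y" if "vge x y" for x y
    using mono that unfolding monotonicity_def by blast
  note cst_iff = constant_preference_iff[OF mono icrp isu]
  have "\<exists>\<theta>. R x (cst \<theta>) \<and> R (cst \<theta>) x" for x
  proof -
    \<comment> \<open>\<open>c\<close> runs through the constants between two bounds of
      \<open>x\<close>. \<open>A\<close> and \<open>B\<close> are closed, nonempty and cover the
      connected unit interval, so they meet.\<close>
    define c where "c = (\<lambda>\<alpha>. \<alpha> *\<^sub>R cst (norm x) + (1 - \<alpha>) *\<^sub>R cst (- norm x))"
    define A where "A = {\<alpha> \<in> {0..1}. R (c \<alpha>) x}"
    define B where "B = {\<alpha> \<in> {0..1}. R x (c \<alpha>)}"
    have x: "R (cst (norm x)) x" "R x (cst (- norm x))"
      by (rule vgeR, rule vge_norm)+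
    then have "closed A" "closed B"
      using cont unfolding continuity_def A_def B_def c_def by blast+
    moreover have "{0..1} \<subseteq> A \<union> B"
      using wo by (auto simp: A_def B_def weak_order_def)
    moreover have "1 \<in> A" "0 \<in> B"
      using x by (auto simp: A_def B_def c_def)
    ultimately have "A \<inter> B \<noteq> {}"
      using connected_Icc[of "0::real" 1] unfolding connected_closed
      by (metis (no_types, lifting) IntI atLeastAtMost_iff empty_iff inf_bot_left order_refl zero_le_one)
    moreover have "\<exists>\<theta>. c \<alpha> = cst \<theta>" for \<alpha>
      unfolding c_def by (auto simp flip: cst_add)
    ultimately obtain \<alpha> \<theta> where "\<alpha> \<in> A" "\<alpha> \<in> B" "c \<alpha> = cst \<theta>" by blast
    then show ?thesis by (auto simp: A_def B_def)
  qed
  then obtain I where I: "\<And>x. R x (cst (I x))" "\<And>x. R (cst (I x)) x" by metis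
  have R_iff: "R x y \<longleftrightarrow> I y \<le> I x" for x y
    using I[of x] I[of y] trans cst_iff by meson
  have ce: "constant_equivalent R I"
    unfolding constant_equivalent_def using I R_iff by blast
  \<comment> \<open>Indifference to a constant determines \<open>I x\<close>, so equations for
    \<open>I\<close> reduce to such indifferences.\<close>
  have eqI: "I x = \<theta>" if "R x (cst \<theta>)" "R (cst \<theta>) x" for x \<theta>
    using that I[of x] trans cst_iff by (meson order_antisym)
  have I_trans: "I (x + cst \<theta>) = I x + \<theta>" for x \<theta>
    using shift[OF I(1), of x \<theta>] shift[OF I(2), of x \<theta>] by (intro eqI) (simp_all add: cst_add)
  have "I 0 = 0"
    by (rule eqI) (simp_all add: vgeR vge_def)
  then have "niveloid \<S> I"
    using I_trans vgeR itis unfolding niveloid_def R_iff ITIS_def by blast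
  moreover have hom: "I (c *\<^sub>R x) = c * I x" if "0 < c" for c x
    using scale[OF I(1), of c x] scale[OF I(2), of c x] that by (intro eqI) simp_all
  moreover have "I x + I y \<le> I (x + y)" for x y
  proof -
    \<comment> \<open>Both shifted arguments have level 0, so their midpoint is weakly preferred to
      0; homogeneity then removes the factor \<open>1/2\<close>.\<close>
    have "R (x + cst (- I x)) (cst 0)" "R (y + cst (- I y)) (cst 0)"
      using \<open>I 0 = 0\<close> by (simp_all add: R_iff I_trans)
    then have "R ((1/2) *\<^sub>R (x + cst (- I x)) + (1 - 1/2) *\<^sub>R (y + cst (- I y))) (cst 0)"
      using conv[unfolded convexity_def, rule_format, of "x + cst (- I x)" 0 "y + cst (- I y)" "1/2"]
      by linarith
    also have "(1/2) *\<^sub>R (x + cst (- I x)) + (1 - 1/2) *\<^sub>R (y + cst (- I y))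
        = (1/2) *\<^sub>R ((x + y) + cst (- (I x + I y)))"
      by (rule bcontfun_eqI) (simp add: algebra_simps)
    finally show ?thesis
      using \<open>I 0 = 0\<close> hom[of "1/2" "(x + y) + cst (- (I x + I y))"] by (simp add: R_iff I_trans)
  qed
  ultimately show ?thesis
    using that ce unfolding superlinear_def by blast
qed

section \<open>From superlinear niveloids back to the axioms\<close>

text \<open>The shift of \<open>y\<close> by \<open>norm (x - y)\<close> dominates \<open>x\<close>,
  so monotonicity and translation invariance bound \<open>I x - I y\<close>.\<close>

lemma niveloid_lipschitz:
  assumes "niveloid \<S> I"
  shows "1-lipschitz_on UNIV I"
proof (rule lipschitz_onI)
  fix x y
  have le: "I x \<le> I y + norm (x - y)" for x y
  proof -
    have "vge (y + cst (norm (x - y))) x"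
      using vge_norm(1)[of "x - y"] by (simp add: vge_def algebra_simps)
    then show ?thesis
      using niveloid_mono[OF assms] niveloid_add_cst[OF assms] by metis
  qed
  show "dist (I x) (I y) \<le> 1 * dist x y"
    using le[of x y] le[of y x] by (simp add: dist_norm abs_le_iff norm_minus_commute)
qed simp

text \<open>Continuity comes from the Lipschitz estimate along segments, Convexity from the
  concavity of \<open>I\<close>.\<close>

lemma superlinear_niveloid_axioms:
  assumes niv: "niveloid \<S> I" and sup: "superlinear I"
  defines "R \<equiv> \<lambda>x y. I y \<le> I x"
  shows "weak_order R" "monotonicity R" "continuity R" "ICRP R" "convexity R" "ISU R"
proof -
  show "weak_order R"
    by (auto simp: weak_order_def R_def)
  show "monotonicity R"
    using niveloid_mono[OF niv] niveloid_cst[OF niv] by (simp add: monotonicity_def R_def del: cst_0)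
  show "ICRP R"
    using niveloid_add_cst[OF niv] by (simp add: ICRP_def R_def)
  show "ISU R"
    using superlinear_scaleR_nonneg[OF sup] by (auto simp: ISU_def R_def intro: mult_left_mono)
  show "convexity R"
    unfolding convexity_def R_def niveloid_cst[OF niv]
  proof (intro allI impI)
    fix x y \<theta> and t :: real
    assume *: "\<theta> \<le> I x" "\<theta> \<le> I y" "0 \<le> t" "t \<le> 1"
    have "\<theta> = t * \<theta> + (1 - t) * \<theta>" by (simp add: algebra_simps)
    also have "\<dots> \<le> t * I x + (1 - t) * I y"
      using * by (intro add_mono mult_left_mono) auto
    also have "\<dots> \<le> I (t *\<^sub>R x + (1 - t) *\<^sub>R y)"
      using superlinear_add[OF sup, of "t *\<^sub>R x" "(1 - t) *\<^sub>R y"] *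
      by (simp add: superlinear_scaleR_nonneg[OF sup])
    finally show "\<theta> \<le> I (t *\<^sub>R x + (1 - t) *\<^sub>R y)" .
  qed
  have "continuous_on UNIV (\<lambda>\<alpha>::real. I (\<alpha> *\<^sub>R x + (1 - \<alpha>) *\<^sub>R z))" for x z
    by (rule continuous_on_compose2[OF lipschitz_on_continuous_on[OF niveloid_lipschitz[OF niv]]])
      (auto intro!: continuous_intros)
  then show "continuity R"
    unfolding continuity_def R_def Collect_conj_eq Collect_mem_eq
    by (intro allI impI conjI closed_Int closed_Collect_le closed_atLeastAtMost continuous_on_const) auto
qed

section \<open>Probabilities as positive functionals\<close>

lemma apply_ind: "apply_bcontfun (ind A) = indicator A"
  unfolding ind_def
  by (rule Bcontfun_inverse, rule bcontfun_normI[of _ 1]) (auto simp: indicator_def)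

lemma apply_bcontfun_sum: "apply_bcontfun (sum f A) n = (\<Sum>a\<in>A. apply_bcontfun (f a) n)"
  for f :: "'a \<Rightarrow> linf"
  by (induction A rule: infinite_finite_induct) auto

text \<open>\<open>Delta\<close> gives signs only on indicators. A nonnegative \<open>x\<close> is
  approximated uniformly by nonnegative combinations of indicators of its superlevel sets, and norm
  continuity of \<open>p\<close> absorbs the error.\<close>

lemma Delta_nonneg:
  assumes p: "p \<in> Delta" and x: "vge x 0"
  shows "0 \<le> blinfun_apply p x"
proof (rule field_le_epsilon)
  fix e :: real assume e: "0 < e"
  define \<delta> where "\<delta> = e / (norm p + 1)"
  have "0 < norm p + 1" using norm_ge_zero[of p] by linarith
  then have \<delta>: "0 < \<delta>" "norm p * \<delta> \<le> e"
    using e by (simp_all add: \<delta>_def field_simps)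
  \<comment> \<open>No value of \<open>x\<close> passes more than \<open>N\<close> levels of height
    \<open>\<delta>\<close>, so \<open>s\<close> is \<open>x\<close> rounded down to multiples of
    \<open>\<delta>\<close>.\<close>
  define N where "N = nat \<lfloor>norm x / \<delta>\<rfloor>"
  define s where "s = (\<Sum>k\<in>{1..N}. \<delta> *\<^sub>R ind {n. \<delta> * real k \<le> apply_bcontfun x n})"
  have "norm (x - s) \<le> \<delta>"
  proof (rule norm_bound)
    fix n
    define m where "m = nat \<lfloor>apply_bcontfun x n / \<delta>\<rfloor>"
    have xn: "0 \<le> apply_bcontfun x n" "apply_bcontfun x n \<le> norm x"
      using x norm_bounded[of x n] by (auto simp: vge_def)
    have nonneg: "0 \<le> apply_bcontfun x n / \<delta>" using xn \<delta> by simp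
    have mN: "m \<le> N"
      unfolding m_def N_def using xn \<delta> by (intro nat_mono floor_mono divide_right_mono) auto
    have km: "\<delta> * real k \<le> apply_bcontfun x n \<longleftrightarrow> k \<le> m" for k
    proof -
      have "\<delta> * real k \<le> apply_bcontfun x n \<longleftrightarrow> real k \<le> apply_bcontfun x n / \<delta>"
        using \<delta> by (simp add: field_simps)
      also have "\<dots> \<longleftrightarrow> k \<le> m"
        unfolding m_def using nonneg by (simp add: le_nat_iff le_floor_iff)
      finally show ?thesis .
    qed
    have card: "{k \<in> {1..N}. \<delta> * real k \<le> apply_bcontfun x n} = {1..m}"
      unfolding km using mN by auto
    have "apply_bcontfun s n = (\<Sum>k\<in>{1..N}. if \<delta> * real k \<le> apply_bcontfun x n then \<delta> else 0)"
      unfolding s_def apply_bcontfun_sum by (intro sum.cong refl) (simp add: apply_ind indicator_def)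
    also have "\<dots> = (\<Sum>k\<in>{1..m}. \<delta>)"
      unfolding card[symmetric] by (rule sum.inter_filter[symmetric]) simp
    finally have "apply_bcontfun s n = \<delta> * real m" by simp
    moreover have "real m \<le> apply_bcontfun x n / \<delta>" "apply_bcontfun x n / \<delta> < real m + 1"
      unfolding m_def using nonneg by simp_all
    then have "\<delta> * real m \<le> apply_bcontfun x n" "apply_bcontfun x n \<le> \<delta> * real m + \<delta>"
      using \<delta> by (simp_all add: field_simps)
    ultimately show "norm (apply_bcontfun (x - s) n) \<le> \<delta>" by simp
  qed
  then have "norm p * norm (x - s) \<le> norm p * \<delta>"
    by (intro mult_left_mono) auto
  then have "\<bar>blinfun_apply p (x - s)\<bar> \<le> e"
    using norm_blinfun[of p "x - s"] \<delta>(2) by simp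
  moreover have "0 \<le> blinfun_apply p s"
    unfolding s_def blinfun.sum_right blinfun.scaleR_right
    using p \<delta> by (intro sum_nonneg) (auto simp: Delta_def)
  ultimately show "0 \<le> blinfun_apply p x + e"
    by (simp add: blinfun.diff_right)
qed

lemma Delta_mono:
  assumes "p \<in> Delta" "vge x y"
  shows "blinfun_apply p y \<le> blinfun_apply p x"
  using Delta_nonneg[OF assms(1), of "x - y"] assms(2) by (simp add: vge_def blinfun.diff_right)

lemma Delta_cst: "p \<in> Delta \<Longrightarrow> blinfun_apply p (cst \<theta>) = \<theta>"
  using blinfun.scaleR_right[of p \<theta> "cst 1"] by (simp add: Delta_def)

section \<open>Minima over sets of probabilities\<close>

text \<open>Every inequality is tested at a minimizer for its larger side; equalities follow by
  reversing the shift or the scaling. The operator set is empty because invariance is treated in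
  \<open>min_rep_ITIS\<close>, where the eigenvalue bound enters.\<close>

lemma min_rep_superlinear_niveloid:
  assumes D: "D \<subseteq> Delta" and rep: "min_rep D I"
  shows "niveloid {} I" "superlinear I"
proof -
  have le: "I x \<le> blinfun_apply p x" if "p \<in> D" for p x
    using rep that unfolding min_rep_def by blast
  have att: "\<exists>p\<in>D. blinfun_apply p x = I x" for x
    using rep unfolding min_rep_def by blast
  obtain p0 where "p0 \<in> D" "blinfun_apply p0 0 = I 0" using att by blast
  then have "I 0 = 0" by simp
  moreover have "I y \<le> I x" if "vge x y" for x y
    using att[of x] le D Delta_mono[OF _ that] by (metis order_trans subsetD)
  moreover have trans_le: "I (x + cst \<theta>) \<le> I x + \<theta>" for x \<theta>
    using att[of x] le D by (metis Delta_cst blinfun.add_right subsetD)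
  have "I (x + cst \<theta>) = I x + \<theta>" for x \<theta>
    using trans_le[of x \<theta>] trans_le[of "x + cst \<theta>" "- \<theta>"] by (simp add: add.assoc flip: cst_add)
  ultimately show "niveloid {} I" unfolding niveloid_def by blast
  have "I x + I y \<le> I (x + y)" for x y
    using att[of "x + y"] le by (metis add_mono blinfun.add_right)
  moreover have scale_le: "I (c *\<^sub>R x) \<le> c * I x" for c x
    using att[of x] le by (metis blinfun.scaleR_right real_scaleR_def)
  have "I (c *\<^sub>R x) = c * I x" if "0 < c" for c x
    using scale_le[of c x] scale_le[of "inverse c" "c *\<^sub>R x"] that by (simp add: field_simps)
  ultimately show "superlinear I" unfolding superlinear_def by blast
qed

text \<open>With \<open>p\<close> a minimizer at \<open>x + S d\<close>, the value there is a convex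
  combination of \<open>p x\<close> and \<open>p (x + d)\<close>, both at least \<open>I x\<close>.
  The bound \<open>le1\<close> keeps the weight \<open>1 - c\<close> nonnegative.\<close>

lemma min_rep_ITIS:
  assumes D: "D \<subseteq> Delta" and rep: "min_rep D I" and S: "positive_op S"
    and eig: "\<forall>p\<in>D. eigenvector S p" and le1: "\<forall>p\<in>D. blinfun_apply (adjoint_op S p) (cst 1) \<le> 1"
  shows "ITIS S (\<lambda>x y. I y \<le> I x)"
  unfolding ITIS_def
proof (intro allI impI)
  fix x d assume xd: "I x \<le> I (x + d)"
  obtain p where p: "p \<in> D" "blinfun_apply p (x + blinfun_apply S d) = I (x + blinfun_apply S d)"
    using rep unfolding min_rep_def by blast
  have pD: "p \<in> Delta" using p(1) D by blast
  obtain c where c: "adjoint_op S p = c *\<^sub>R p"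
    using eig p(1) unfolding eigenvector_def by blast
  have app: "blinfun_apply p (blinfun_apply S y) = c * blinfun_apply p y" for y
    using arg_cong[OF c, of "\<lambda>q. blinfun_apply q y"] by (simp add: adjoint_op_def scaleR_blinfun.rep_eq)
  have "vge (blinfun_apply S (cst 1)) 0"
    using S by (simp add: positive_op_def vge_def)
  \<comment> \<open>Since \<open>p\<close> has mass 1, \<open>c\<close> equals
    \<open>p (S 1)\<close>.\<close>
  then have "0 \<le> c"
    using Delta_nonneg[OF pD] app[of "cst 1"] Delta_cst[OF pD] by fastforce
  have "c \<le> 1"
    using le1 p(1) by (force simp: c scaleR_blinfun.rep_eq Delta_cst[OF pD])
  have "I x \<le> blinfun_apply p x" "I x \<le> blinfun_apply p x + blinfun_apply p d"
    using rep p(1) xd unfolding min_rep_def by (metis, metis blinfun.add_right order_trans)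
  then have "(1 - c) * I x + c * I x \<le> (1 - c) * blinfun_apply p x + c * (blinfun_apply p x + blinfun_apply p d)"
    using \<open>0 \<le> c\<close> \<open>c \<le> 1\<close> by (intro add_mono mult_left_mono) auto
  then show "I x \<le> I (x + blinfun_apply S d)"
    unfolding p(2)[symmetric] blinfun.add_right app by (simp add: algebra_simps)
qed

section \<open>The weak-star topology and the representing set\<close>

text \<open>On functionals, \<open>weak_star\<close> is the same pullback as the strong operator
  topology.\<close>

lemma continuous_map_weak_star_eval: "continuous_map weak_star euclidean (\<lambda>p. blinfun_apply p x)"
  using strong_operator_topology_continuous_evaluation[of x]
  unfolding weak_star_def strong_operator_topology_def .

lemma topspace_weak_star [simp]: "topspace weak_star = UNIV"
  by (simp add: weak_star_def topspace_pullback_topology)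

lemma closedin_weak_star_le:
  assumes "continuous_map weak_star euclidean f"
  shows "closedin weak_star {p. a \<le> (f p :: real)}"
  using closedin_continuous_map_preimage[OF assms, of "{a..}"] by simp

lemma closedin_weak_star_eq:
  assumes "continuous_map weak_star euclidean f" "continuous_map weak_star euclidean g"
  shows "closedin weak_star {p. f p = (g p :: real)}"
  using closedin_continuous_map_preimage[OF continuous_map_diff[OF assms], of "{0}"] by simp

text \<open>Fixing the eigenvalue as \<open>p (S 1)\<close> removes the existential from the
  eigenvector condition, so \<open>D\<close> is cut out by closed conditions on evaluations.
  \<open>supporting_eigenvector\<close> supplies an element of \<open>D\<close> touching
  \<open>I\<close> at each \<open>x\<close>.\<close>

lemma superlinear_niveloid_min_rep:
  assumes I: "niveloid \<S> I" "superlinear I"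
  defines "D \<equiv> {p::ba. (\<forall>x. I x \<le> blinfun_apply p x) \<and> (\<forall>S\<in>\<S>. \<forall>x.
    blinfun_apply p (blinfun_apply S x) = blinfun_apply p (blinfun_apply S (cst 1)) * blinfun_apply p x)}"
  shows "closedin weak_star D" "D \<subseteq> {p \<in> Delta. \<forall>S\<in>\<S>. eigenvector S p}" "min_rep D I"
proof -
  have "D = (\<Inter>x. {p. I x \<le> blinfun_apply p x}) \<inter> (\<Inter>(S, x) \<in> \<S> \<times> UNIV. {p. blinfun_apply p
      (blinfun_apply S x) = blinfun_apply p (blinfun_apply S (cst 1)) * blinfun_apply p x})"
    unfolding D_def by auto
  also have "closedin weak_star \<dots>"
  \<comment> \<open>The empty index set is split off because \<open>closedin_INT\<close> needs a
    nonempty one.\<close>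
  proof (cases "\<S> = {}")
    case True
    then show ?thesis
      by (auto intro!: closedin_weak_star_le continuous_map_weak_star_eval)
  next
    case False
    then show ?thesis
      by (auto intro!: closedin_Int closedin_INT closedin_weak_star_le closedin_weak_star_eq
          continuous_map_real_mult continuous_map_weak_star_eval)
  qed
  finally show "closedin weak_star D" .
  show "D \<subseteq> {p \<in> Delta. \<forall>S\<in>\<S>. eigenvector S p}"
  proof
    fix p assume p: "p \<in> D"
    have le: "I x \<le> blinfun_apply p x" for x using p by (simp add: D_def)
    \<comment> \<open>Domination at \<open>cst 1\<close> and at its negative bounds the mass of
      \<open>p\<close> from both sides.\<close>
    have "cst (- 1) = - cst 1" by (rule bcontfun_eqI) simp
    then have p1: "blinfun_apply p (cst 1) = 1"
      using le[of "cst 1"] le[of "cst (- 1)"] niveloid_cst[OF I(1), of 1] niveloid_cst[OF I(1), of "- 1"]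
      by (simp add: blinfun.minus_right)
    have "0 \<le> blinfun_apply p (ind A)" for A
      using niveloid_mono[OF I(1), of "ind A" 0] le[of "ind A"]
      by (simp add: niveloid_0[OF I(1)] vge_def apply_ind)
    then have "p \<in> Delta" using p1 by (simp add: Delta_def)
    moreover have "eigenvector S p" if "S \<in> \<S>" for S
      unfolding eigenvector_def
    proof
      show "p \<noteq> 0" using p1 by auto
      have "adjoint_op S p = blinfun_apply p (blinfun_apply S (cst 1)) *\<^sub>R p"
      proof (rule blinfun_eqI)
        fix y
        have "blinfun_apply p (blinfun_apply S y)
            = blinfun_apply p (blinfun_apply S (cst 1)) * blinfun_apply p y"
          using p that unfolding D_def by blast
        then show "blinfun_apply (adjoint_op S p) y
            = blinfun_apply (blinfun_apply p (blinfun_apply S (cst 1)) *\<^sub>R p) y"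
          unfolding adjoint_op_def blinfun_apply_blinfun_compose scaleR_blinfun.rep_eq by simp
      qed
      then show "\<exists>c. adjoint_op S p = c *\<^sub>R p" by blast
    qed
    ultimately show "p \<in> {p \<in> Delta. \<forall>S\<in>\<S>. eigenvector S p}" by blast
  qed
  show "min_rep D I"
    unfolding min_rep_def
  proof (intro allI conjI)
    fix x
    obtain p where p: "blinfun_apply p x = I x" "\<And>y. I y \<le> blinfun_apply p y"
      "\<And>S y. S \<in> \<S> \<Longrightarrow> blinfun_apply p (blinfun_apply S y)
        = blinfun_apply p (blinfun_apply S (cst 1)) * blinfun_apply p y"
      using supporting_eigenvector[OF I] by blast
    then have "p \<in> D" unfolding D_def by blast
    with p(1) show "\<exists>p\<in>D. blinfun_apply p x = I x" by blast
  qed (simp add: D_def)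
qed

theorem theorem3:
  fixes K :: "'k set" and T :: "'k \<Rightarrow> linf \<Rightarrow>\<^sub>L linf"
  assumes pos: "\<forall>i\<in>K. positive_op (T i)"
  defines "F \<equiv> {p \<in> Delta. \<forall>i\<in>K. eigenvector (T i) p}"
  shows "(\<forall>R. weak_order R \<and> monotonicity R \<and> continuity R \<and> ICRP R \<and> convexity R \<and> ISU R
              \<and> (\<forall>i\<in>K. ITIS (T i) R) \<longrightarrow>
            (\<exists>D. D \<noteq> {} \<and> closedin weak_star D \<and> D \<subseteq> F \<and>
              (\<exists>I. min_rep D I \<and> constant_equivalent R I \<and>
                   (\<forall>J. constant_equivalent R J \<longrightarrow> J = I))))
       \<and> (\<forall>D I. D \<noteq> {} \<and> closedin weak_star D \<and> D \<subseteq> F \<and> min_rep D I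
              \<and> (\<forall>p\<in>F. \<forall>i\<in>K. blinfun_apply (adjoint_op (T i) p) (cst 1) \<le> 1) \<longrightarrow>
            (let R = (\<lambda>x y. I y \<le> I x) in
              weak_order R \<and> monotonicity R \<and> continuity R \<and> ICRP R \<and> convexity R \<and> ISU R
              \<and> (\<forall>i\<in>K. ITIS (T i) R)))"
proof (intro conjI allI impI)
  fix R
  assume "weak_order R \<and> monotonicity R \<and> continuity R \<and> ICRP R \<and> convexity R \<and> ISU R
    \<and> (\<forall>i\<in>K. ITIS (T i) R)"
  then have R: "weak_order R" "monotonicity R" "continuity R" "ICRP R" "convexity R" "ISU R"
    and itis: "\<forall>S\<in>T ` K. ITIS S R" by auto
  obtain I where I: "constant_equivalent R I" "niveloid (T ` K) I" "superlinear I"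
    using superlinear_niveloid_representation[OF R itis] by blast
  obtain D where D: "closedin weak_star D" "D \<subseteq> {p \<in> Delta. \<forall>S\<in>T ` K. eigenvector S p}" "min_rep D I"
    using superlinear_niveloid_min_rep[OF I(2,3)] by blast
  have "D \<subseteq> F" using D(2) by (auto simp: F_def)
  moreover have "D \<noteq> {}" using D(3) by (auto simp: min_rep_def)
  moreover have "J = I" if "constant_equivalent R J" for J
    using constant_equivalent_unique[OF I(1) that R(1)] constant_preference_iff[OF R(2,4,6)] by blast
  ultimately show "\<exists>D. D \<noteq> {} \<and> closedin weak_star D \<and> D \<subseteq> F \<and>
      (\<exists>I. min_rep D I \<and> constant_equivalent R I \<and> (\<forall>J. constant_equivalent R J \<longrightarrow> J = I))"
    using D(1,3) I(1) by blast
next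
  fix D I
  assume *: "D \<noteq> {} \<and> closedin weak_star D \<and> D \<subseteq> F \<and> min_rep D I
    \<and> (\<forall>p\<in>F. \<forall>i\<in>K. blinfun_apply (adjoint_op (T i) p) (cst 1) \<le> 1)"
  then have D: "D \<subseteq> Delta" and rep: "min_rep D I" by (auto simp: F_def)
  \<comment> \<open>Membership in \<open>F\<close> provides both the eigenvectors and the eigenvalue
    bound.\<close>
  have "ITIS (T i) (\<lambda>x y. I y \<le> I x)" if "i \<in> K" for i
    using * pos that by (intro min_rep_ITIS[OF D rep]) (auto simp: F_def)
  with superlinear_niveloid_axioms[OF min_rep_superlinear_niveloid[OF D rep]]
  show "let R = (\<lambda>x y. I y \<le> I x) in
      weak_order R \<and> monotonicity R \<and> continuity R \<and> ICRP R \<and> convexity R \<and> ISU R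
      \<and> (\<forall>i\<in>K. ITIS (T i) R)"
    unfolding Let_def by blast
qed

end
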